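(* Let $n\ge 2$ be a fixed integer and, for $\varepsilon\in[0,1]$, define $$\rho_n(\varepsilon)=\left[\min_{1\le k\le n-1}\left(1-\frac{k\varepsilon}{n}\right)^{n-k}\left(1+\frac{(n-k)\varepsilon}{n}\right)^{k}\right]^{1/n}$$ (the minimum being over integers $k$). Then, as $\varepsilon\to 0$, $$\rho_n(\varepsilon)=1-\frac{\lfloor n^2/4\rfloor}{2n^2}\,\varepsilon^2+O(\varepsilon^3)\ \ge\ 1-\frac18\varepsilon^2-O(\varepsilon^3),$$ and in particular $\rho_n(\varepsilon)\to 1$ as $\varepsilon\to 0$.
   Context: The implied constants in $O(\cdot)$ may depend on the fixed $n$; the limit is over $\varepsilon\in[0,1]$ tending to $0$. *)

theory Defs
  imports "HOL-Analysis.Analysis" "HOL-Library.Landau_Symbols"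
begin

(* Only meant for n >= 2 (so that the minimum is over a nonempty set) and 0 <= \<epsilon> <= 1
   (so that all factors are positive and "root n" is the power 1/n). *)
definition rho :: "nat \<Rightarrow> real \<Rightarrow> real" where
  "rho n \<epsilon> = root n (MIN k\<in>{1..n-1}.
     (1 - real k * \<epsilon> / real n) ^ (n - k) * (1 + real (n - k) * \<epsilon> / real n) ^ k)"

end

theory Submission
  imports Defs "HOL-Real_Asymp.Real_Asymp"
begin

text \<open>
  The \<open>n\<close>-th root is monotone, so it can be moved inside the minimum. With \<open>a = k/n\<close>, the \<open>k\<close>-th
  root is \<open>exp ((1 - a) ln (1 - a \<epsilon>) + a ln (1 + (1 - a) \<epsilon>))\<close>, in whose exponent the linear terms
  cancel: it is \<open>1 - a (1 - a) \<epsilon>\<^sup>2 / 2 + O(\<epsilon>\<^sup>3)\<close>. A minimum of finitely many functions moves by at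
  most the sum of the perturbations, and \<open>k (n - k)\<close> is largest at \<open>k = \<lfloor>n/2\<rfloor>\<close>, with value
  \<open>\<lfloor>n\<^sup>2/4\<rfloor>\<close>.
\<close>

lemma ln_one_plus_bigo:
  fixes c :: real
  assumes "c \<noteq> 0"
  shows "(\<lambda>x. ln (1 + c * x) - (c * x - (c * x)\<^sup>2 / 2)) \<in> O[at_right 0](\<lambda>x. x ^ 3)"
proof -
  have ln: "(\<lambda>x::real. ln (1 + x) - (x - x\<^sup>2 / 2)) \<in> O[at 0](\<lambda>x. x ^ 3)"
    by real_asymp
  \<comment> \<open>The Taylor remainder is transported along \<open>x \<mapsto> c * x\<close>. As
    \<open>c\<close> may be negative, the image filter is the two-sided \<open>at 0\<close>;
    \<open>c \<noteq> 0\<close> keeps \<open>c * x\<close> inside the punctured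
    neighbourhood.\<close>
  have lim: "filterlim (\<lambda>x. c * x) (at 0) (at_right 0)"
  proof (rule filterlim_atI)
    show "((\<lambda>x. c * x) \<longlongrightarrow> 0) (at_right 0)"
      by real_asymp
    show "\<forall>\<^sub>F x in at_right 0. c * x \<noteq> 0"
      using assms by (simp add: eventually_at_filter)
  qed
  have "(\<lambda>x. ln (1 + c * x) - (c * x - (c * x)\<^sup>2 / 2)) \<in> O[at_right 0](\<lambda>x. (c * x) ^ 3)"
    using landau_o.big.compose[OF ln lim] .
  then show ?thesis
    using assms by (simp add: power_mult_distrib)
qed

lemma exp_minus_linear_bigo:
  fixes f :: "'a \<Rightarrow> real"
  assumes "(f \<longlongrightarrow> 0) F"
  shows "(\<lambda>x. exp (f x) - (1 + f x)) \<in> O[F](\<lambda>x. (f x)\<^sup>2)"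
proof -
  have "(\<lambda>y::real. exp y - (1 + y)) \<in> O[at 0](\<lambda>y. y\<^sup>2)"
    by real_asymp
  then obtain c where "\<forall>\<^sub>F y::real in at 0. norm (exp y - (1 + y)) \<le> c * norm (y\<^sup>2)"
    by (elim landau_o.bigE)
  \<comment> \<open>At \<open>y = 0\<close> both sides vanish, so the bound extends to the full
    neighbourhood. This allows \<open>f\<close> to take the value 0.\<close>
  then have "\<forall>\<^sub>F y::real in nhds 0. norm (exp y - (1 + y)) \<le> c * norm (y\<^sup>2)"
    by (simp add: eventually_nhds_conv_at)
  from eventually_compose_filterlim[OF this assms] show ?thesis
    by (rule bigoI)
qed

text \<open>The exponential is the geometric mean of \<open>1 - a * x\<close> and
  \<open>1 + (1 - a) * x\<close> with weights \<open>1 - a\<close> and \<open>a\<close>. Their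
  arithmetic mean with these weights is exactly 1, hence no linear term survives.\<close>

lemma weighted_geometric_mean_bigo:
  fixes a :: real
  assumes "0 < a" "a < 1"
  shows "(\<lambda>x. exp ((1 - a) * ln (1 - a * x) + a * ln (1 + (1 - a) * x))
            - (1 - a * (1 - a) / 2 * x\<^sup>2)) \<in> O[at_right 0](\<lambda>x. x ^ 3)"
proof -
  define y where "y x = (1 - a) * ln (1 - a * x) + a * ln (1 + (1 - a) * x)" for x
  \<comment> \<open>The logarithmic expansion is used with \<open>c = - a\<close> and
    \<open>c = 1 - a\<close>. The quadratic coefficients add up to \<open>- (a * (1 - a)\<^sup>2 +
    (1 - a) * a\<^sup>2) / 2 = - a * (1 - a) / 2\<close>.\<close>
  have "(\<lambda>x. (1 - a) * (ln (1 + (- a) * x) - ((- a) * x - ((- a) * x)\<^sup>2 / 2))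
           + a * (ln (1 + (1 - a) * x) - ((1 - a) * x - ((1 - a) * x)\<^sup>2 / 2)))
         \<in> O[at_right 0](\<lambda>x. x ^ 3)"
    using assms by (intro sum_in_bigo landau_o.big.mult_in_1 landau_o.big.cmult_in_iff[THEN iffD2]
        ln_one_plus_bigo) auto
  also have "(\<lambda>x. (1 - a) * (ln (1 + (- a) * x) - ((- a) * x - ((- a) * x)\<^sup>2 / 2))
           + a * (ln (1 + (1 - a) * x) - ((1 - a) * x - ((1 - a) * x)\<^sup>2 / 2)))
         = (\<lambda>x. y x - (- (a * (1 - a) / 2) * x\<^sup>2))"
    by (rule ext) (simp add: y_def field_simps power2_eq_square)
  finally have y: "(\<lambda>x. y x - (- (a * (1 - a) / 2) * x\<^sup>2)) \<in> O[at_right 0](\<lambda>x. x ^ 3)" .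
  \<comment> \<open>Since the exponent is of order \<open>x\<^sup>2\<close>, linearising
    \<open>exp\<close> costs only its square, of order \<open>x ^ 4\<close>.\<close>
  have "(\<lambda>x. y x - (- (a * (1 - a) / 2) * x\<^sup>2)) \<in> O[at_right 0](\<lambda>x. x\<^sup>2)"
    by (rule landau_o.big_trans[OF y]) real_asymp
  from sum_in_bigo(1)[OF this, of "\<lambda>x. - (a * (1 - a) / 2) * x\<^sup>2"]
  have y2: "y \<in> O[at_right 0](\<lambda>x. x\<^sup>2)"
    by simp
  have "(y \<longlongrightarrow> 0) (at_right 0)"
    unfolding y_def using assms by real_asymp
  from exp_minus_linear_bigo[OF this]
  have "(\<lambda>x. exp (y x) - (1 + y x)) \<in> O[at_right 0](\<lambda>x. (y x)\<^sup>2)" .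
  also have "(\<lambda>x. (y x)\<^sup>2) \<in> O[at_right 0](\<lambda>x. (x\<^sup>2)\<^sup>2)"
    by (rule landau_o.big_power[OF y2])
  also have "(\<lambda>x::real. (x\<^sup>2)\<^sup>2) \<in> O[at_right 0](\<lambda>x. x ^ 3)"
    by real_asymp
  finally have "(\<lambda>x. exp (y x) - (1 + y x)) \<in> O[at_right 0](\<lambda>x. x ^ 3)" .
  from sum_in_bigo(1)[OF this y] show ?thesis
    by (simp add: y_def algebra_simps)
qed

text \<open>Evaluating \<open>f\<close> at a minimiser of \<open>g\<close> bounds one minimum by the
  other; exchanging \<open>f\<close> and \<open>g\<close> gives the absolute value. The sum, rather
  than the maximum, of the differences is convenient because finite sums preserve big-O
  bounds.\<close>

lemma Min_diff_le_sum:
  fixes f g :: "'a \<Rightarrow> real"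
  assumes "finite A" "A \<noteq> {}"
  shows "\<bar>Min (f ` A) - Min (g ` A)\<bar> \<le> (\<Sum>k\<in>A. \<bar>f k - g k\<bar>)"
proof -
  have le: "Min (f ` A) \<le> Min (g ` A) + (\<Sum>k\<in>A. \<bar>f k - g k\<bar>)" for f g :: "'a \<Rightarrow> real"
  proof -
    have "Min (g ` A) \<in> g ` A"
      using assms by (intro Min_in) auto
    then obtain k where k: "k \<in> A" "Min (g ` A) = g k"
      by blast
    have "Min (f ` A) \<le> f k"
      using assms k by simp
    moreover have "\<bar>f k - g k\<bar> \<le> (\<Sum>k\<in>A. \<bar>f k - g k\<bar>)"
      using assms k by (intro member_le_sum) auto
    ultimately show ?thesis
      using k by linarith
  qed
  show ?thesis
    using le[of f g] le[of g f] by (simp add: abs_le_iff abs_minus_commute)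
qed

text \<open>This is the AM-GM inequality \<open>4 * k * m \<le> (k + m)\<^sup>2\<close> with
  \<open>m = n - k\<close>; rounding down is harmless because \<open>k * m\<close> is an
  integer.\<close>

lemma mult_diff_le:
  fixes k n :: nat
  assumes "k \<le> n"
  shows "k * (n - k) \<le> n\<^sup>2 div 4"
proof -
  obtain m where m: "n = k + m"
    using assms le_Suc_ex by blast
  have "4 * (real k * real m) \<le> (real k + real m)\<^sup>2"
    using sum_squares_bound[of "real k" "real m"] by (simp add: power2_sum)
  then have "real (4 * (k * m)) \<le> real ((k + m)\<^sup>2)"
    by simp
  then have "4 * (k * m) \<le> (k + m)\<^sup>2"
    by (simp only: of_nat_le_iff)
  then show ?thesis
    by (simp add: m)
qed

lemma half_mult_diff_half:
  fixes n :: nat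
  shows "(n div 2) * (n - n div 2) = n\<^sup>2 div 4"
proof (cases "even n")
  case True
  then show ?thesis by (auto simp: power2_eq_square elim!: evenE)
next
  case False
  then obtain m where "n = 2 * m + 1" by (auto elim: oddE)
  \<comment> \<open>The remainder 1 is what \<open>div 4\<close> discards, leaving the product of
    the two halves \<open>m\<close> and \<open>m + 1\<close>.\<close>
  moreover have "(2 * m + 1)\<^sup>2 = 4 * (m * (m + 1)) + 1"
    by (simp add: power2_eq_square algebra_simps)
  ultimately show ?thesis by simp
qed

lemma Min_quadratic:
  fixes x :: real
  assumes "n \<ge> 2"
  shows "(MIN k\<in>{1..n-1}. 1 - real (k * (n - k)) / (2 * (real n)\<^sup>2) * x\<^sup>2)
           = 1 - real (n\<^sup>2 div 4) / (2 * (real n)\<^sup>2) * x\<^sup>2"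
proof (rule Min_eqI)
  fix y assume "y \<in> (\<lambda>k. 1 - real (k * (n - k)) / (2 * (real n)\<^sup>2) * x\<^sup>2) ` {1..n-1}"
  then obtain k where k: "k \<in> {1..n-1}" "y = 1 - real (k * (n - k)) / (2 * (real n)\<^sup>2) * x\<^sup>2"
    by blast
  have "real (k * (n - k)) \<le> real (n\<^sup>2 div 4)"
    using k(1) by (intro of_nat_mono mult_diff_le) auto
  then have "real (k * (n - k)) / (2 * (real n)\<^sup>2) * x\<^sup>2 \<le> real (n\<^sup>2 div 4) / (2 * (real n)\<^sup>2) * x\<^sup>2"
    by (intro mult_right_mono divide_right_mono) auto
  then show "1 - real (n\<^sup>2 div 4) / (2 * (real n)\<^sup>2) * x\<^sup>2 \<le> y"
    using k by simp
next
  show "1 - real (n\<^sup>2 div 4) / (2 * (real n)\<^sup>2) * x\<^sup>2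
      \<in> (\<lambda>k. 1 - real (k * (n - k)) / (2 * (real n)\<^sup>2) * x\<^sup>2) ` {1..n-1}"
    unfolding half_mult_diff_half[of n, symmetric]
    \<comment> \<open>The minimiser \<open>n div 2\<close> lies in \<open>{1..n-1}\<close> because
      \<open>n \<ge> 2\<close>.\<close>
    using assms by (intro image_eqI[of _ _ "n div 2"]) auto
qed simp

lemma rho_eq_Min:
  assumes "n \<ge> 2" "0 < x" "x \<le> 1"
  shows "rho n x = (MIN k\<in>{1..n-1}.
           exp ((1 - real k / real n) * ln (1 - real k / real n * x)
                + real k / real n * ln (1 + (1 - real k / real n) * x)))"
proof -
  have "mono (root n)"
    using assms by (intro monoI) simp
  moreover have "finite {1..n-1}" "{1..n-1} \<noteq> {}"
    using assms by auto
  ultimately have "rho n x = (MIN k\<in>{1..n-1}.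
     root n ((1 - real k * x / real n) ^ (n - k) * (1 + real (n - k) * x / real n) ^ k))"
    unfolding rho_def by (subst mono_Min_commute) (auto simp: image_image)
  also have "\<dots> = (MIN k\<in>{1..n-1}.
           exp ((1 - real k / real n) * ln (1 - real k / real n * x)
                + real k / real n * ln (1 + (1 - real k / real n) * x)))"
  proof (intro arg_cong[where f = Min] image_cong refl)
    fix k assume "k \<in> {1..n-1}"
    then have k: "k < n" by auto
    define p where "p = 1 - real k * x / real n"
    define q where "q = 1 + real (n - k) * x / real n"
    \<comment> \<open>Together with \<open>x \<le> 1\<close>, the strict bound \<open>k < n\<close>
      makes the first base positive, so that logarithms can be taken.\<close>
    have "real k * x < real n"
      using k assms mult_left_mono[of x 1 "real k"] by simp
    then have p: "p > 0"
      using assms by (simp add: p_def field_simps)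
    have q: "q > 0"
      using assms by (simp add: q_def add_pos_nonneg)
    have "root n (p ^ (n - k) * q ^ k) = exp (ln (p ^ (n - k) * q ^ k) / real n)"
      using p q assms by (simp add: root_powr_inverse powr_def)
    also have "ln (p ^ (n - k) * q ^ k) / real n
        = (1 - real k / real n) * ln p + real k / real n * ln q"
      using p q k by (simp add: ln_mult ln_realpow of_nat_diff field_simps)
    moreover have "p = 1 - real k / real n * x"
      by (simp add: p_def)
    moreover have "q = 1 + (1 - real k / real n) * x"
      using k by (simp add: q_def of_nat_diff field_simps)
    ultimately show "root n ((1 - real k * x / real n) ^ (n - k) * (1 + real (n - k) * x / real n) ^ k)
      = exp ((1 - real k / real n) * ln (1 - real k / real n * x)
                + real k / real n * ln (1 + (1 - real k / real n) * x))"
      unfolding p_def[symmetric] q_def[symmetric] by metis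
  qed
  finally show ?thesis .
qed

lemma rho_expansion:
  assumes "n \<ge> 2"
  shows "(\<lambda>x. rho n x - (1 - real (n\<^sup>2 div 4) / (2 * (real n)\<^sup>2) * x\<^sup>2))
           \<in> O[at_right 0](\<lambda>x. x ^ 3)"
proof -
  define h where "h k x = exp ((1 - real k / real n) * ln (1 - real k / real n * x)
                + real k / real n * ln (1 + (1 - real k / real n) * x))" for k x
  define t where "t k x = 1 - real (k * (n - k)) / (2 * (real n)\<^sup>2) * x\<^sup>2" for k x
  have "(\<lambda>x. h k x - t k x) \<in> O[at_right 0](\<lambda>x. x ^ 3)" if "k \<in> {1..n-1}" for k
  proof -
    have k: "0 < k" "k < n" using that by auto
    \<comment> \<open>With \<open>a = k / n\<close>, the coefficient \<open>a * (1 - a) / 2\<close>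
      is \<open>k * (n - k) / (2 * n\<^sup>2)\<close>.\<close>
    have "t k x = 1 - real k / real n * (1 - real k / real n) / 2 * x\<^sup>2" for x
      using k by (simp add: t_def of_nat_diff field_simps power2_eq_square)
    with weighted_geometric_mean_bigo[of "real k / real n"] k show ?thesis
      by (simp add: h_def)
  qed
  then have sum: "(\<lambda>x. \<Sum>k\<in>{1..n-1}. \<bar>h k x - t k x\<bar>) \<in> O[at_right 0](\<lambda>x. x ^ 3)"
    by (intro big_sum_in_bigo) simp
  \<comment> \<open>The exponential form of \<open>rho\<close> is available only for
    \<open>0 < x \<le> 1\<close>, which holds eventually.\<close>
  have "\<forall>\<^sub>F x in at_right 0. x \<in> {0<..1::real}"
    by (auto simp: eventually_at_right_field intro!: exI[of _ 1])
  then have "\<forall>\<^sub>F x in at_right 0.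
      norm (rho n x - (1 - real (n\<^sup>2 div 4) / (2 * (real n)\<^sup>2) * x\<^sup>2))
        \<le> norm (\<Sum>k\<in>{1..n-1}. \<bar>h k x - t k x\<bar>)"
  proof eventually_elim
    case (elim x)
    have "rho n x = (MIN k\<in>{1..n-1}. h k x)"
      using rho_eq_Min[of n x] assms elim by (simp add: h_def)
    moreover have "1 - real (n\<^sup>2 div 4) / (2 * (real n)\<^sup>2) * x\<^sup>2 = (MIN k\<in>{1..n-1}. t k x)"
      using Min_quadratic[of n x] assms by (simp add: t_def)
    ultimately show ?case
      using Min_diff_le_sum[of "{1..n-1}" "\<lambda>k. h k x" "\<lambda>k. t k x"] assms by simp
  qed
  then show ?thesis
    by (rule landau_o.big.trans[OF landau_o.big_mono sum])
qed

theorem mainTheorem4: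
  fixes n :: nat
  assumes "n \<ge> 2"
  shows "(\<lambda>\<epsilon>. rho n \<epsilon> - (1 - real_of_int \<lfloor>(real n)\<^sup>2 / 4\<rfloor> / (2 * (real n)\<^sup>2) * \<epsilon>\<^sup>2))
             \<in> O[at 0 within {0..1}](\<lambda>\<epsilon>. \<epsilon> ^ 3)
       \<and> (\<exists>g \<in> O[at 0 within {0..1}](\<lambda>\<epsilon>. \<epsilon> ^ 3).
             \<forall>\<^sub>F \<epsilon> in at 0 within {0..1}. rho n \<epsilon> \<ge> 1 - 1 / 8 * \<epsilon>\<^sup>2 - g \<epsilon>)
       \<and> (rho n \<longlongrightarrow> 1) (at 0 within {0..1})"
proof -
  define c where "c = real (n\<^sup>2 div 4) / (2 * (real n)\<^sup>2)"
  define r where "r x = rho n x - (1 - c * x\<^sup>2)" for x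
  have F: "at 0 within {0..1} = at_right (0::real)"
    by (simp add: at_within_Icc_at_right)
  have floor: "real_of_int \<lfloor>(real n)\<^sup>2 / 4\<rfloor> = real (n\<^sup>2 div 4)"
    using floor_divide_of_nat_eq[of "n\<^sup>2" 4, where 'a=real] by simp
  have r: "r \<in> O[at_right 0](\<lambda>x. x ^ 3)"
    unfolding r_def[abs_def] c_def by (rule rho_expansion[OF assms])
  have "c \<le> 1 / 8"
  proof -
    have "4 * (n\<^sup>2 div 4) \<le> n\<^sup>2" by simp
    then have "4 * real (n\<^sup>2 div 4) \<le> (real n)\<^sup>2"
      by (metis of_nat_le_iff of_nat_mult of_nat_numeral of_nat_power)
    then show ?thesis
      using assms by (simp add: c_def field_simps)
  qed
  \<comment> \<open>The witness for the error term is \<open>- r\<close>: replacing \<open>c\<close>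
    by the larger \<open>1 / 8\<close> only lowers the right-hand side, so the inequality holds for
    every \<open>x\<close>.\<close>
  then have lower: "rho n x \<ge> 1 - 1 / 8 * x\<^sup>2 - (- r x)" for x
    using mult_right_mono[of c "1 / 8" "x\<^sup>2"] by (simp add: r_def)
  have neg: "(\<lambda>x. - r x) \<in> O[at_right 0](\<lambda>x. x ^ 3)"
    using r by simp
  have lim: "(rho n \<longlongrightarrow> 1) (at_right 0)"
  proof -
    have "r \<in> o[at_right 0](\<lambda>_. 1)"
      by (rule landau_o.big_small_trans[OF r]) real_asymp
    then have "(r \<longlongrightarrow> 0) (at_right 0)"
      by (auto dest: smalloD_tendsto)
    moreover have "((\<lambda>x. 1 - c * x\<^sup>2) \<longlongrightarrow> 1) (at_right 0)"
      by real_asymp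
    ultimately have "((\<lambda>x. r x + (1 - c * x\<^sup>2)) \<longlongrightarrow> 0 + 1) (at_right 0)"
      by (rule tendsto_add)
    then show ?thesis
      by (simp add: r_def)
  qed
  show ?thesis
    unfolding F floor c_def[symmetric] r_def[symmetric]
    by (intro conjI bexI[OF _ neg] always_eventually allI lower lim r)
qed

end
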